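(* Let $(G,P)$ be a lattice ordered group and let $T:P\to\mathcal{B}(\mathcal{H})$ be a contractive Nica-covariant representation. Then $T$ is regular.
   Context: A lattice ordered group $(G,P)$ is a (not necessarily abelian) group $G$ with identity $e$ together with a subsemigroup $P\subseteq G$ containing $e$ such that $PP^{-1}=G$, $P\cap P^{-1}=\{e\}$, $gPg^{-1}\subseteq P$ for all $g\in G$, and such that, for the partial order $x\le y\iff x^{-1}y\in P$, any two elements $x,y\in G$ have a least upper bound $x\vee y$ and a greatest lower bound $x\wedge y$. Every $g\in G$ is uniquely written $g=g_+g_-^{-1}$ with $g_+,g_-\in P$ and $g_+\wedge g_-=e$; namely $g_+=g\vee e$, $g_-=g^{-1}\vee e$. $\mathcal{H}$ is a Hilbert space. A representation $T:P\to\mathcal{B}(\mathcal{H})$ is a unital semigroup homomorphism ($T(e)=I$, $T(pq)=T(p)T(q)$); it is contractive if $\|T(p)\|\le 1$ for all $p\in P$, and Nica-covariant if $T(s)T(t)^*=T(t)^*T(s)$ whenever $s,t\in P$ satisfy $s\wedge t=e$. A unital map $S:G\to\mathcal{B}(\mathcal{H})$ is completely positive definite if $[S(g_i^{-1}g_j)]_{1\le i,j\le n}\ge 0$ for all $n$ and all $g_1,\dots,g_n\in G$ ($i$ row index, $j$ column index). $T$ is regular (i.e. right regular) if $\tilde T(g)=T(g_-)^*T(g_+)$ is completely positive definite on $G$. *)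

theory Defs
  imports "HOL-Analysis.Analysis" "HOL-Algebra.Coset"
begin

section \<open>Complex Hilbert spaces\<close>

text \<open>The inner product is linear in the first argument. The real scalar multiplication
  inherited from \<^class>\<open>banach\<close> is the restriction of the complex one, and the norm (for which
  the space is complete) is the one induced by the inner product.\<close>

class complex_hilbert_space = banach +
  fixes scaleC :: "complex \<Rightarrow> 'a \<Rightarrow> 'a" (infixr "*\<^sub>C" 75)
    and cinner :: "'a \<Rightarrow> 'a \<Rightarrow> complex"
  assumes scaleC_add_right: "c *\<^sub>C (x + y) = c *\<^sub>C x + c *\<^sub>C y"
    and scaleC_add_left: "(c + d) *\<^sub>C x = c *\<^sub>C x + d *\<^sub>C x"
    and scaleC_scaleC: "c *\<^sub>C d *\<^sub>C x = (c * d) *\<^sub>C x"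
    and scaleR_scaleC: "r *\<^sub>R x = complex_of_real r *\<^sub>C x"
    and cinner_commute: "cinner x y = cnj (cinner y x)"
    and cinner_add_left: "cinner (x + y) z = cinner x z + cinner y z"
    and cinner_scaleC_left: "cinner (c *\<^sub>C x) y = c * cinner x y"
    and norm_sq_cinner: "complex_of_real ((norm x)\<^sup>2) = cinner x x"

instantiation complex :: complex_hilbert_space
begin

definition scaleC_complex :: "complex \<Rightarrow> complex \<Rightarrow> complex"
  where "scaleC_complex c x = c * x"

definition cinner_complex :: "complex \<Rightarrow> complex \<Rightarrow> complex"
  where "cinner_complex x y = x * cnj y"

instance
  by standard
    (simp_all add: scaleC_complex_def cinner_complex_def algebra_simps scaleR_conv_of_real
      complex_norm_square del: of_real_power)

end

definition bounded_clinear :: "('h::complex_hilbert_space \<Rightarrow> 'h) \<Rightarrow> bool"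
  where "bounded_clinear A \<longleftrightarrow> bounded_linear A \<and> (\<forall>c x. A (c *\<^sub>C x) = c *\<^sub>C A x)"

definition cadjoint :: "('h::complex_hilbert_space \<Rightarrow> 'h) \<Rightarrow> 'h \<Rightarrow> 'h"
  where "cadjoint A = (THE B. \<forall>x y. cinner (A x) y = cinner x (B y))"

text \<open>An operator matrix \<open>A\<close> of size \<open>n\<close> acts on the Hilbert space direct sum of \<open>n\<close> copies of the
  space, whose elements are given by the values at \<open>i < n\<close> of a function on the naturals. It is
  positive if \<open>\<langle>A h, h\<rangle>\<close> is a nonnegative real number for every vector \<open>h\<close> of the direct sum.\<close>

definition opmat_apply ::
    "nat \<Rightarrow> (nat \<Rightarrow> nat \<Rightarrow> 'h \<Rightarrow> 'h) \<Rightarrow> (nat \<Rightarrow> 'h) \<Rightarrow> nat \<Rightarrow> 'h::complex_hilbert_space"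
  where "opmat_apply n A h i = (\<Sum>j<n. A i j (h j))"

definition direct_sum_cinner ::
    "nat \<Rightarrow> (nat \<Rightarrow> 'h::complex_hilbert_space) \<Rightarrow> (nat \<Rightarrow> 'h) \<Rightarrow> complex"
  where "direct_sum_cinner n h k = (\<Sum>i<n. cinner (h i) (k i))"

definition opmat_nonneg :: "nat \<Rightarrow> (nat \<Rightarrow> nat \<Rightarrow> 'h \<Rightarrow> 'h::complex_hilbert_space) \<Rightarrow> bool"
  where "opmat_nonneg n A \<longleftrightarrow>
    (\<forall>h. direct_sum_cinner n (opmat_apply n A h) h \<in> \<real>\<^sub>\<ge>\<^sub>0)"


section \<open>Lattice ordered groups\<close>

definition cone_order :: "('g, 'm) monoid_scheme \<Rightarrow> 'g set \<Rightarrow> 'g gorder"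
  where "cone_order G P =
    \<lparr>carrier = carrier G, eq = (=), le = (\<lambda>x y. inv\<^bsub>G\<^esub> x \<otimes>\<^bsub>G\<^esub> y \<in> P)\<rparr>"

locale lattice_ordered_group = group G for G (structure) +
  fixes P :: "'a set"
  assumes cone_submonoid: "submonoid P G"
    and cone_generates: "P <#> set_inv P = carrier G"
    and cone_pointed: "P \<inter> set_inv P = {\<one>}"
    and cone_normal: "g \<in> carrier G \<Longrightarrow> g <# P #> inv g \<subseteq> P"
    and cone_lub: "\<lbrakk>x \<in> carrier G; y \<in> carrier G\<rbrakk> \<Longrightarrow> \<exists>s. is_lub (cone_order G P) s {x, y}"
    and cone_glb: "\<lbrakk>x \<in> carrier G; y \<in> carrier G\<rbrakk> \<Longrightarrow> \<exists>s. is_glb (cone_order G P) s {x, y}"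

definition pos_part :: "('g, 'm) monoid_scheme \<Rightarrow> 'g set \<Rightarrow> 'g \<Rightarrow> 'g"
  where "pos_part G P g = g \<squnion>\<^bsub>cone_order G P\<^esub> \<one>\<^bsub>G\<^esub>"

definition neg_part :: "('g, 'm) monoid_scheme \<Rightarrow> 'g set \<Rightarrow> 'g \<Rightarrow> 'g"
  where "neg_part G P g = inv\<^bsub>G\<^esub> g \<squnion>\<^bsub>cone_order G P\<^esub> \<one>\<^bsub>G\<^esub>"


section \<open>Representations and regularity\<close>

text \<open>Maps defined on \<open>P\<close> or on the group are total functions in HOL; all conditions below only
  concern their values on \<open>P\<close> and on the carrier, respectively.\<close>

definition semigroup_representation ::
    "('g, 'm) monoid_scheme \<Rightarrow> 'g set \<Rightarrow> ('g \<Rightarrow> 'h \<Rightarrow> 'h::complex_hilbert_space) \<Rightarrow> bool"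
  where "semigroup_representation G P T \<longleftrightarrow>
    (\<forall>p\<in>P. bounded_clinear (T p)) \<and>
    T \<one>\<^bsub>G\<^esub> = id \<and>
    (\<forall>p\<in>P. \<forall>q\<in>P. T (p \<otimes>\<^bsub>G\<^esub> q) = T p \<circ> T q)"

definition contractive :: "'g set \<Rightarrow> ('g \<Rightarrow> 'h \<Rightarrow> 'h::complex_hilbert_space) \<Rightarrow> bool"
  where "contractive P T \<longleftrightarrow> (\<forall>p\<in>P. onorm (T p) \<le> 1)"

definition nica_covariant ::
    "('g, 'm) monoid_scheme \<Rightarrow> 'g set \<Rightarrow> ('g \<Rightarrow> 'h \<Rightarrow> 'h::complex_hilbert_space) \<Rightarrow> bool"
  where "nica_covariant G P T \<longleftrightarrow>
    (\<forall>s\<in>P. \<forall>t\<in>P. s \<sqinter>\<^bsub>cone_order G P\<^esub> t = \<one>\<^bsub>G\<^esub> \<longrightarrow>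
      T s \<circ> cadjoint (T t) = cadjoint (T t) \<circ> T s)"

definition completely_positive_definite ::
    "('g, 'm) monoid_scheme \<Rightarrow> ('g \<Rightarrow> 'h \<Rightarrow> 'h::complex_hilbert_space) \<Rightarrow> bool"
  where "completely_positive_definite G S \<longleftrightarrow>
    (\<forall>g\<in>carrier G. bounded_clinear (S g)) \<and>
    S \<one>\<^bsub>G\<^esub> = id \<and>
    (\<forall>n g. (\<forall>i<n. g i \<in> carrier G) \<longrightarrow>
      opmat_nonneg n (\<lambda>i j. S (inv\<^bsub>G\<^esub> (g i) \<otimes>\<^bsub>G\<^esub> g j)))"

definition regular_extension ::
    "('g, 'm) monoid_scheme \<Rightarrow> 'g set \<Rightarrow> ('g \<Rightarrow> 'h \<Rightarrow> 'h::complex_hilbert_space) \<Rightarrow> 'g \<Rightarrow> 'h \<Rightarrow> 'h"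
  where "regular_extension G P T g = cadjoint (T (neg_part G P g)) \<circ> T (pos_part G P g)"

definition regular ::
    "('g, 'm) monoid_scheme \<Rightarrow> 'g set \<Rightarrow> ('g \<Rightarrow> 'h \<Rightarrow> 'h::complex_hilbert_space) \<Rightarrow> bool"
  where "regular G P T \<longleftrightarrow> completely_positive_definite G (regular_extension G P T)"

end

theory Submission
  imports Defs
begin

text \<open>
  Write \<open>q\<^sub>i = g\<^sub>i\<^sup>-\<^sup>1\<close>. The positive and negative parts of \<open>g\<^sub>i\<^sup>-\<^sup>1 g\<^sub>j = q\<^sub>i q\<^sub>j\<^sup>-\<^sup>1\<close> are
  \<open>(q\<^sub>i \<or> q\<^sub>j) q\<^sub>j\<^sup>-\<^sup>1\<close> and \<open>(q\<^sub>i \<or> q\<^sub>j) q\<^sub>i\<^sup>-\<^sup>1\<close>, so regularity says that the sums of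
  \<open>k\<^sub>i\<^sub>j(q\<^sub>i \<or> q\<^sub>j)\<close> with \<open>k\<^sub>i\<^sub>j(x) = \<langle>T(x q\<^sub>j\<^sup>-\<^sup>1) h\<^sub>j, T(x q\<^sub>i\<^sup>-\<^sup>1) h\<^sub>i\<rangle>\<close> over all \<open>i, j < n\<close> are nonnegative.
  The proof has two halves, both phrased with the alternating sums
  \<open>\<Sum>\<^bsub>S \<subseteq> L\<^esub> (-1)\<^bsup>|S|\<^esup> f(x \<or> \<Or>S)\<close> attached to a finite list \<open>L\<close> of group elements.

  The first half is Moebius inversion. Let \<open>F\<close> be a finite set that contains all \<open>q\<^sub>i\<close> and is
  closed under joins. Going through \<open>F\<close> from the top downwards, one splits the sum into one
  contribution per \<open>r \<in> F\<close>: the alternating sum at base point \<open>r\<close> over the elements already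
  treated. Only the indices with \<open>q\<^sub>i \<le> r\<close> enter this contribution, and for \<open>x \<ge> r\<close> the
  operator \<open>T(x q\<^sub>i\<^sup>-\<^sup>1)\<close> factors through \<open>T(r q\<^sub>i\<^sup>-\<^sup>1)\<close>. Hence the contribution is
  the value at the single vector \<open>\<Sum>\<^sub>i T(r q\<^sub>i\<^sup>-\<^sup>1) h\<^sub>i\<close> of a Brehmer type form
  \<open>\<Sum>\<^bsub>S \<subseteq> as\<^esub> (-1)\<^bsup>|S|\<^esup> \<parallel>T(\<Or>S) h\<parallel>\<^sup>2\<close> for a list \<open>as\<close> in the cone
  (\<open>kernel_sum_nonneg_above\<close>, \<open>kernel_sum_nonneg\<close>).

  The second half shows that this form is nonnegative (\<open>defect_form_nonneg\<close>), by induction on the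
  length of the list. If the first entry \<open>a\<close> is disjoint from all others, Nica covariance makes
  \<open>T(a)\<close> and \<open>T(a)\<^sup>*\<close> adjoint to each other also for the form \<open>B\<close> of the remaining list, and a
  contraction with a contractive adjoint for a positive bounded form does not increase that form, so
  \<open>B(h, h) - B(T(a) h, T(a) h) \<ge> 0\<close> (\<open>psd_form_contraction\<close>). If \<open>a\<close> meets another entry \<open>c\<close> in
  \<open>b = a \<and> c\<close>, the form is the sum of the one with \<open>a\<close> replaced by \<open>b\<close>, where \<open>c\<close> has become
  redundant, and of the one for the remainders modulo \<open>b\<close>, evaluated at \<open>T(b) h\<close>, where \<open>a\<close> and
  \<open>c\<close> have become disjoint while earlier disjointness persists (\<open>defect_form_split\<close>).
\<close>

section \<open>Positive bilinear forms\<close>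

text \<open>If the first step went up, log-convexity would make every later ratio at least as large, and the
  sequence would grow geometrically.\<close>

lemma bounded_log_convex_not_increasing:
  fixes w :: "nat \<Rightarrow> real"
  assumes nonneg: "\<And>n. 0 \<le> w n" and bound: "\<And>n. w n \<le> K"
    and convex: "\<And>n. (w (Suc n))\<^sup>2 \<le> w n * w (Suc (Suc n))"
  shows "w 1 \<le> w 0"
proof (rule ccontr)
  assume "\<not> w 1 \<le> w 0"
  then have less: "w 0 < w 1" by simp
  have "w 0 \<noteq> 0"
    using convex[of 0] less by auto
  then have pos0: "0 < w 0" using nonneg[of 0] by simp
  define r where "r = w 1 / w 0"
  have r1: "1 < r" using less pos0 by (simp add: r_def)
  have ratio: "0 < w n \<and> r * w n \<le> w (Suc n)" for n
  proof (induction n)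
    case 0
    show ?case using pos0 by (simp add: r_def)
  next
    case (Suc n)
    have pos: "0 < w (Suc n)" using Suc r1 by (smt (verit) mult_pos_pos)
    have "w n * (r * w (Suc n)) \<le> w (Suc n) * w (Suc n)"
      using Suc pos by (simp add: mult.commute mult.left_commute)
    also have "\<dots> \<le> w n * w (Suc (Suc n))"
      using convex[of n] by (simp add: power2_eq_square)
    finally show ?case using Suc pos by simp
  qed
  have grow: "r ^ n * w 0 \<le> w n" for n
  proof (induction n)
    case (Suc n)
    have "r ^ Suc n * w 0 \<le> r * w n" using Suc r1 by simp
    also have "\<dots> \<le> w (Suc n)" using ratio by blast
    finally show ?case .
  qed simp
  obtain n where "K / w 0 < r ^ n" using real_arch_pow[OF r1] by blast
  then have "K < r ^ n * w 0" using pos0 by (simp add: pos_divide_less_eq)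
  then show False using grow[of n] bound[of n] by linarith
qed

lemma psd_form_Cauchy_Schwarz:
  fixes \<beta> :: "'a::real_vector \<Rightarrow> 'a \<Rightarrow> real"
  assumes bil: "bilinear \<beta>" and sym: "\<And>x y. \<beta> x y = \<beta> y x" and psd: "\<And>x. 0 \<le> \<beta> x x"
  shows "(\<beta> x y)\<^sup>2 \<le> \<beta> x x * \<beta> y y"
proof -
  have quad: "0 \<le> \<beta> x x + 2 * t * \<beta> x y + t\<^sup>2 * \<beta> y y" for t
  proof -
    have "\<beta> (x + t *\<^sub>R y) (x + t *\<^sub>R y) = \<beta> x x + 2 * t * \<beta> x y + t\<^sup>2 * \<beta> y y"
      using sym[of y x]
      by (simp add: bilinear_ladd[OF bil] bilinear_radd[OF bil] bilinear_lmul[OF bil]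
          bilinear_rmul[OF bil] power2_eq_square algebra_simps)
    then show ?thesis using psd[of "x + t *\<^sub>R y"] by simp
  qed
  show ?thesis
  proof (cases "\<beta> y y = 0")
    case True
    have "\<beta> x y = 0"
    proof (rule ccontr)
      assume "\<beta> x y \<noteq> 0"
      then show False
        using quad[of "- (\<beta> x x + 1) / (2 * \<beta> x y)"] True by (simp add: field_simps)
    qed
    then show ?thesis using True by simp
  next
    case False
    then have pos: "0 < \<beta> y y" using psd[of y] by simp
    have "0 \<le> \<beta> x x - (\<beta> x y)\<^sup>2 / \<beta> y y"
      using quad[of "- \<beta> x y / \<beta> y y"] pos
      by (simp add: field_simps power2_eq_square)
    then show ?thesis using pos by (simp add: field_simps)
  qed
qed

text \<open>For the form \<open>\<langle>D x, y\<rangle>\<close> of a positive operator \<open>D\<close> commuting with \<open>A\<close> this is the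
  factorization \<open>D\<^sup>1\<^sup>/\<^sup>2 (1 - A\<^sup>*A) D\<^sup>1\<^sup>/\<^sup>2 \<ge> 0\<close> of \<open>D - A\<^sup>* D A\<close>. Iterating the
  Cauchy-Schwarz inequality avoids the square root: the values of the form along the orbit of
  \<open>B \<circ> A\<close> are log-convex and, as \<open>A\<close> and \<open>B\<close> are contractions, bounded.\<close>

lemma psd_form_contraction:
  fixes \<beta> :: "'a::real_normed_vector \<Rightarrow> 'a \<Rightarrow> real"
  assumes bil: "bilinear \<beta>" and sym: "\<And>x y. \<beta> x y = \<beta> y x" and psd: "\<And>x. 0 \<le> \<beta> x x"
    and bound: "\<And>x. \<beta> x x \<le> M * (norm x)\<^sup>2"
    and adj: "\<And>x y. \<beta> (A x) y = \<beta> x (B y)"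
    and A: "\<And>x. norm (A x) \<le> norm x" and B: "\<And>x. norm (B x) \<le> norm x"
  shows "\<beta> (A x) (A x) \<le> \<beta> x x"
proof -
  note CS = psd_form_Cauchy_Schwarz[OF bil sym psd]
  define y where "y n = ((B \<circ> A) ^^ n) x" for n
  define w where "w n = \<beta> (y n) (y n)" for n
  have y_Suc: "y (Suc n) = B (A (y n))" for n by (simp add: y_def)
  have norm_y: "norm (y n) \<le> norm x" for n
  proof (induction n)
    case 0
    show ?case by (simp add: y_def)
  next
    case (Suc n)
    then show ?case using A[of "y n"] B[of "A (y n)"] by (simp add: y_Suc)
  qed
  have adj': "\<beta> (B u) v = \<beta> u (A v)" for u v
    using adj[of v u] sym by metis
  have convex: "(w (Suc n))\<^sup>2 \<le> w n * w (Suc (Suc n))" for n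
  proof -
    have "w (Suc n) = \<beta> (B (A (y n))) (y (Suc n))" by (simp add: w_def y_Suc)
    also have "\<dots> = \<beta> (y n) (y (Suc (Suc n)))" by (simp add: adj adj' y_Suc)
    finally show ?thesis using CS[of "y n" "y (Suc (Suc n))"] by (simp add: w_def)
  qed
  have "w n \<le> \<bar>M\<bar> * (norm x)\<^sup>2" for n
  proof -
    have "w n \<le> M * (norm (y n))\<^sup>2" using bound by (simp add: w_def)
    also have "\<dots> \<le> \<bar>M\<bar> * (norm x)\<^sup>2"
      using norm_y[of n] by (intro mult_mono power_mono) auto
    finally show ?thesis .
  qed
  then have "w 1 \<le> w 0"
    using convex psd by (intro bounded_log_convex_not_increasing) (simp_all add: w_def)
  have w0: "w 0 = \<beta> x x" by (simp add: w_def y_def)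
  have "\<beta> (A x) (A x) = \<beta> x (y 1)" by (simp add: adj y_def)
  then have "(\<beta> (A x) (A x))\<^sup>2 \<le> w 0 * w 1"
    using CS[of x "y 1"] by (simp add: w_def y_def)
  also have "\<dots> \<le> (w 0)\<^sup>2"
    using \<open>w 1 \<le> w 0\<close> psd by (simp add: power2_eq_square w0 mult_left_mono)
  finally show ?thesis using psd[of x] w0 by (simp add: power2_le_iff_abs_le)
qed

section \<open>Riesz representation and adjoints\<close>

text \<open>The real part is used because all forms below are real; the imaginary part of the complex
  inner product is recovered by \<open>Im_cinner\<close>.\<close>

definition rinner :: "'h::complex_hilbert_space \<Rightarrow> 'h \<Rightarrow> real"
  where "rinner x y = Re (cinner x y)"

lemma cinner_add_right: "cinner x (y + z) = cinner x y + cinner x z"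
  using cinner_commute[of x "y + z"] cinner_commute[of x y] cinner_commute[of x z]
  by (simp add: cinner_add_left)

lemma cinner_scaleC_right: "cinner x (c *\<^sub>C y) = cnj c * cinner x y"
  using cinner_commute[of x "c *\<^sub>C y"] cinner_commute[of x y]
  by (simp add: cinner_scaleC_left)

lemma rinner_bilinear: "bilinear (rinner :: 'h::complex_hilbert_space \<Rightarrow> 'h \<Rightarrow> real)"
  unfolding bilinear_def
  by (auto intro!: linearI simp: rinner_def cinner_add_right cinner_add_left scaleR_scaleC
      cinner_scaleC_left cinner_scaleC_right)

lemma rinner_commute: "rinner x y = rinner y x"
  using cinner_commute[of x y] by (simp add: rinner_def)

lemma rinner_self: "rinner x x = (norm x)\<^sup>2"
  using norm_sq_cinner[of x] by (metis rinner_def Re_complex_of_real)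

lemmas rinner_simps = bilinear_ladd[OF rinner_bilinear] bilinear_radd[OF rinner_bilinear]
  bilinear_lsub[OF rinner_bilinear] bilinear_rsub[OF rinner_bilinear]
  bilinear_lmul[OF rinner_bilinear] bilinear_rmul[OF rinner_bilinear]

lemma rinner_Cauchy_Schwarz: "\<bar>rinner x y\<bar> \<le> norm x * norm y"
proof -
  have "(rinner x y)\<^sup>2 \<le> (norm x * norm y)\<^sup>2"
    using psd_form_Cauchy_Schwarz[OF rinner_bilinear rinner_commute, of x y]
    by (simp add: rinner_self power_mult_distrib)
  then show ?thesis
    using abs_le_square_iff[of "rinner x y" "norm x * norm y"] by simp
qed

lemma Im_cinner: "Im (cinner x y) = - rinner (\<i> *\<^sub>C x) y"
  by (simp add: rinner_def cinner_scaleC_left)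

lemma cinner_eqI:
  assumes "\<And>x. rinner x y = rinner (L x) z" and "\<And>x. L (\<i> *\<^sub>C x) = \<i> *\<^sub>C L x"
  shows "cinner x y = cinner (L x) z"
  by (rule complex_eqI) (use assms in \<open>auto simp: Im_cinner rinner_def[symmetric]\<close>)

lemma cinner_right_cancel:
  assumes "\<And>x. cinner x y = cinner x z"
  shows "y = z"
proof -
  have "rinner (y - z) y = rinner (y - z) z" using assms by (simp add: rinner_def)
  then have "rinner (y - z) (y - z) = 0" by (simp add: rinner_simps)
  then show ?thesis by (simp add: rinner_self)
qed

text \<open>The representing vector is the minimizer of \<open>\<parallel>x\<parallel>\<^sup>2 - 2 \<phi>(x)\<close>. A minimizing sequence is
  Cauchy by the parallelogram law, and the first variation at the minimizer vanishes.\<close>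

theorem Riesz_representation:
  fixes \<phi> :: "'h::complex_hilbert_space \<Rightarrow> real"
  assumes "bounded_linear \<phi>"
  shows "\<exists>z. \<forall>x. \<phi> x = rinner x z"
proof -
  interpret bounded_linear \<phi> by fact
  obtain K where K: "\<And>x. \<bar>\<phi> x\<bar> \<le> norm x * K" using bounded by auto
  define J where "J x = (norm x)\<^sup>2 - 2 * \<phi> x" for x
  have "- K\<^sup>2 \<le> J x" for x
  proof -
    have "0 \<le> (norm x - K)\<^sup>2" by simp
    moreover have "\<phi> x \<le> norm x * K" using K[of x] by linarith
    ultimately show ?thesis
      unfolding J_def by (simp add: power2_eq_square algebra_simps)
  qed
  then have bdd: "bdd_below (range J)" by (auto intro!: bdd_belowI2)
  define m where "m = Inf (range J)"
  have m_le: "m \<le> J x" for x unfolding m_def by (intro cInf_lower bdd) auto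
  have "\<exists>x. J x < m + 1 / real (Suc n)" for n
    using cInf_lessD[of "range J" "m + 1 / real (Suc n)"] by (auto simp: m_def)
  then obtain X where X: "\<And>n. J (X n) < m + 1 / real (Suc n)" by metis
  have parallelogram: "(norm (x - y))\<^sup>2 = 2 * J x + 2 * J y - 4 * J ((1/2) *\<^sub>R (x + y))" for x y
    by (simp add: J_def rinner_self[symmetric] rinner_simps add scaleR
        rinner_commute[of y x] algebra_simps)
  have close: "(norm (X i - X j))\<^sup>2 < 2 * (1 / real (Suc i)) + 2 * (1 / real (Suc j))" for i j
    using parallelogram[of "X i" "X j"] X[of i] X[of j] m_le[of "(1/2) *\<^sub>R (X i + X j)"]
    by linarith
  have "Cauchy X"
  proof (rule CauchyI)
    fix e :: real assume e: "0 < e"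
    obtain N where N: "4 / e\<^sup>2 < real N" using reals_Archimedean2 by blast
    show "\<exists>M. \<forall>i\<ge>M. \<forall>j\<ge>M. norm (X i - X j) < e"
    proof (intro exI allI impI)
      fix i j assume ij: "N \<le> i" "N \<le> j"
      have "0 < 4 / e\<^sup>2" using e by simp
      then have Npos: "0 < real N" using N by linarith
      have "2 / real (Suc i) \<le> 2 / real N" "2 / real (Suc j) \<le> 2 / real N"
        using ij Npos by (auto intro!: divide_left_mono)
      then have "(norm (X i - X j))\<^sup>2 < 4 / real N" using close[of i j] by simp
      also have "\<dots> < e\<^sup>2" using N Npos e by (simp add: field_simps)
      finally show "norm (X i - X j) < e" using e by (simp add: power_less_imp_less_base)
    qed
  qed
  then obtain z where z: "X \<longlonglongrightarrow> z" using Cauchy_convergent_iff convergent_def by blast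
  have "(\<lambda>n. J (X n)) \<longlonglongrightarrow> J z"
    unfolding J_def by (intro tendsto_intros z tendsto)
  moreover have "(\<lambda>n. m + 1 / real (Suc n)) \<longlonglongrightarrow> m + 0"
    by (intro tendsto_intros LIMSEQ_Suc lim_1_over_n)
  ultimately have "J z \<le> m + 0"
    using X by (intro LIMSEQ_le[where X="\<lambda>n. J (X n)"]) (auto intro: less_imp_le)
  then have min: "J z \<le> J x" for x using m_le[of x] by simp
  have "\<phi> x = rinner x z" for x
  proof (cases "x = 0")
    case True
    then show ?thesis by (simp add: zero bilinear_lzero[OF rinner_bilinear])
  next
    case False
    then have pos: "0 < (norm x)\<^sup>2" by simp
    define d where "d = rinner x z - \<phi> x"
    have "(norm (z + t *\<^sub>R x))\<^sup>2 = (norm z)\<^sup>2 + 2 * t * rinner x z + t\<^sup>2 * (norm x)\<^sup>2" for t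
      unfolding rinner_self[symmetric]
      by (simp add: rinner_simps rinner_commute[of z x] algebra_simps power2_eq_square)
    then have "J (z + t *\<^sub>R x) = J z + 2 * t * d + t\<^sup>2 * (norm x)\<^sup>2" for t
      by (simp add: J_def d_def add scaleR algebra_simps)
    then have "0 \<le> 2 * t * d + t\<^sup>2 * (norm x)\<^sup>2" for t using min[of "z + t *\<^sub>R x"] by simp
    \<comment> \<open>The quadratic polynomial in \<open>t\<close> is tested at its minimizer.\<close>
    from this[of "- d / (norm x)\<^sup>2"] have "d\<^sup>2 \<le> 0"
      using pos by (simp add: power2_eq_square divide_simps mult_less_0_iff split: if_splits)
    then show ?thesis by (simp add: d_def)
  qed
  then show ?thesis by blast
qed

lemma bounded_clinear_bounded: "bounded_clinear A \<Longrightarrow> bounded_linear A"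
  by (simp add: bounded_clinear_def)

lemma bounded_clinear_scaleC: "bounded_clinear A \<Longrightarrow> A (c *\<^sub>C x) = c *\<^sub>C A x"
  by (simp add: bounded_clinear_def)

lemma cadjoint_unique:
  assumes "\<And>x y. cinner (A x) y = cinner x (B y)"
  shows "cadjoint A = B"
  unfolding cadjoint_def
proof (rule the_equality)
  fix B' assume "\<forall>x y. cinner (A x) y = cinner x (B' y)"
  then show "B' = B" using assms using assms by (intro ext) (rule cinner_right_cancel, metis)
qed (use assms in simp)

lemma cinner_cadjoint:
  fixes A :: "'h::complex_hilbert_space \<Rightarrow> 'h"
  assumes A: "bounded_clinear A"
  shows "cinner (A x) y = cinner x (cadjoint A y)"
proof -
  have "\<exists>z. \<forall>x. cinner (A x) y = cinner x z" for y
  proof -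
    interpret bounded_linear A using A by (rule bounded_clinear_bounded)
    obtain K where K: "\<And>x. norm (A x) \<le> norm x * K" using bounded by blast
    have "bounded_linear (\<lambda>x. rinner (A x) y)"
    proof (rule bounded_linear_intro[where K="K * norm y"])
      show "norm (rinner (A x) y) \<le> norm x * (K * norm y)" for x
        using rinner_Cauchy_Schwarz[of "A x" y] mult_right_mono[OF K, of "norm y" x]
        by (simp add: mult.assoc)
    qed (simp_all add: add scaleR rinner_simps)
    then obtain z where "\<And>x. rinner (A x) y = rinner x z"
      using Riesz_representation by blast
    then have "cinner x z = cinner (A x) y" for x
      using A by (intro cinner_eqI) (simp_all add: bounded_clinear_scaleC)
    then show ?thesis by metis
  qed
  then obtain B where "\<And>x y. cinner (A x) y = cinner x (B y)" by metis
  with cadjoint_unique[of A B] show ?thesis by simp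
qed

lemma rinner_cadjoint: "bounded_clinear A \<Longrightarrow> rinner (A x) y = rinner x (cadjoint A y)"
  by (simp add: rinner_def cinner_cadjoint)

lemma norm_cadjoint_le:
  fixes A :: "'h::complex_hilbert_space \<Rightarrow> 'h"
  assumes "bounded_clinear A" and "\<And>x. norm (A x) \<le> K * norm x"
  shows "norm (cadjoint A y) \<le> K * norm y"
proof (cases "cadjoint A y = 0")
  case True
  have "0 \<le> K * norm y" by (rule order_trans[OF norm_ge_zero assms(2)])
  then show ?thesis using True by simp
next
  case False
  let ?z = "cadjoint A y"
  have "norm ?z * norm ?z = rinner (A ?z) y"
    using assms(1) by (simp add: rinner_cadjoint rinner_self power2_eq_square)
  also have "\<dots> \<le> norm (A ?z) * norm y" using rinner_Cauchy_Schwarz[of "A ?z" y] by linarith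
  also have "\<dots> \<le> (K * norm ?z) * norm y" by (intro mult_right_mono assms(2)) simp
  finally show ?thesis using False by (simp add: mult.commute mult.left_commute)
qed

lemma bounded_clinear_cadjoint:
  fixes A :: "'h::complex_hilbert_space \<Rightarrow> 'h"
  assumes "bounded_clinear A"
  shows "bounded_clinear (cadjoint A)"
proof -
  note adj = cinner_cadjoint[OF assms, symmetric]
  have scaleC: "cadjoint A (c *\<^sub>C x) = c *\<^sub>C cadjoint A x" for c x
    by (rule cinner_right_cancel) (simp add: cinner_scaleC_right adj)
  obtain K where "\<And>x. norm (A x) \<le> K * norm x"
    using bounded_linear.bounded[OF bounded_clinear_bounded[OF assms]] by (metis mult.commute)
  then have bound: "norm (cadjoint A y) \<le> norm y * K" for y
    using norm_cadjoint_le[OF assms] by (simp add: mult.commute)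
  have "bounded_linear (cadjoint A)"
  proof (rule bounded_linear_intro[OF _ _ bound])
    show "cadjoint A (x + y) = cadjoint A x + cadjoint A y" for x y
      by (rule cinner_right_cancel) (simp add: cinner_add_right adj)
    show "cadjoint A (r *\<^sub>R x) = r *\<^sub>R cadjoint A x" for r x
      by (simp add: scaleR_scaleC scaleC)
  qed
  then show ?thesis using scaleC by (simp add: bounded_clinear_def)
qed

lemma bounded_clinear_compose:
  "bounded_clinear A \<Longrightarrow> bounded_clinear B \<Longrightarrow> bounded_clinear (A \<circ> B)"
  unfolding bounded_clinear_def comp_def using bounded_linear_compose by auto

section \<open>Arithmetic of lattice ordered groups\<close>

context lattice_ordered_group
begin

abbreviation cone_le :: "'a \<Rightarrow> 'a \<Rightarrow> bool" (infix "\<preceq>" 50)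
  where "x \<preceq> y \<equiv> inv x \<otimes> y \<in> P"

abbreviation cone_join :: "'a \<Rightarrow> 'a \<Rightarrow> 'a" (infixl "\<curlyvee>" 65)
  where "x \<curlyvee> y \<equiv> x \<squnion>\<^bsub>cone_order G P\<^esub> y"

abbreviation cone_meet :: "'a \<Rightarrow> 'a \<Rightarrow> 'a" (infixl "\<curlywedge>" 65)
  where "x \<curlywedge> y \<equiv> x \<sqinter>\<^bsub>cone_order G P\<^esub> y"

lemma cone_closed: "p \<in> P \<Longrightarrow> p \<in> carrier G"
  using submonoid.subset[OF cone_submonoid] by blast

lemma one_in_cone: "\<one> \<in> P"
  using submonoid.one_closed[OF cone_submonoid] .

lemma cone_mult: "p \<in> P \<Longrightarrow> q \<in> P \<Longrightarrow> p \<otimes> q \<in> P"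
  using submonoid.m_closed[OF cone_submonoid] .

lemma cone_conj: "p \<in> P \<Longrightarrow> g \<in> carrier G \<Longrightarrow> g \<otimes> p \<otimes> inv g \<in> P"
  using cone_normal[of g] by (auto simp: l_coset_def r_coset_def)

lemma mult_cancel_inv [simp]:
  assumes "x \<in> carrier G" "y \<in> carrier G"
  shows "inv x \<otimes> (x \<otimes> y) = y" and "x \<otimes> (inv x \<otimes> y) = y"
  using assms by (simp_all flip: m_assoc)

lemma cone_le_trans:
  assumes "x \<preceq> y" "y \<preceq> z" and [simp]: "x \<in> carrier G" "y \<in> carrier G" "z \<in> carrier G"
  shows "x \<preceq> z"
proof -
  have "(inv x \<otimes> y) \<otimes> (inv y \<otimes> z) = inv x \<otimes> z"
    by (simp add: m_assoc)
  then show ?thesis using cone_mult[OF assms(1,2)] by simp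
qed

lemma cone_le_antisym:
  assumes "x \<preceq> y" "y \<preceq> x" and [simp]: "x \<in> carrier G" "y \<in> carrier G"
  shows "x = y"
proof -
  have "inv x \<otimes> y = inv (inv y \<otimes> x)" by (simp add: inv_mult_group)
  then have "inv x \<otimes> y \<in> P \<inter> set_inv P"
    using assms(1,2) by (auto simp: SET_INV_def)
  then have "inv x \<otimes> y = \<one>" using cone_pointed by blast
  then show ?thesis by (metis assms(3,4) inv_equality inv_inv inv_closed)
qed

lemma cone_le_mult_left:
  assumes "x \<preceq> y" and [simp]: "x \<in> carrier G" "y \<in> carrier G" "z \<in> carrier G"
  shows "z \<otimes> x \<preceq> z \<otimes> y"
proof -
  have "inv (z \<otimes> x) \<otimes> (z \<otimes> y) = inv x \<otimes> y"
    by (simp add: inv_mult_group m_assoc)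
  then show ?thesis using assms(1) by simp
qed

lemma cone_le_mult_right:
  assumes "x \<preceq> y" and [simp]: "x \<in> carrier G" "y \<in> carrier G" "z \<in> carrier G"
  shows "x \<otimes> z \<preceq> y \<otimes> z"
  using cone_conj[OF assms(1), of "inv z"] by (simp add: inv_mult_group m_assoc)

lemma cone_le_inv:
  assumes "x \<preceq> y" and [simp]: "x \<in> carrier G" "y \<in> carrier G"
  shows "inv y \<preceq> inv x"
  using cone_le_mult_left[OF cone_le_mult_right[OF assms(1), of "inv x"], of "inv y"]
  by (simp add: m_assoc)

lemma lattice_cone_order: "lattice (cone_order G P)"
proof
  fix x y z w
  let ?L = "cone_order G P"
  show "x \<in> carrier ?L \<Longrightarrow> x .=\<^bsub>?L\<^esub> x" by (simp add: cone_order_def)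
  show "x .=\<^bsub>?L\<^esub> y \<Longrightarrow> y .=\<^bsub>?L\<^esub> x" by (simp add: cone_order_def)
  show "x .=\<^bsub>?L\<^esub> y \<Longrightarrow> y .=\<^bsub>?L\<^esub> z \<Longrightarrow> x .=\<^bsub>?L\<^esub> z" by (simp add: cone_order_def)
  show "x \<in> carrier ?L \<Longrightarrow> x \<sqsubseteq>\<^bsub>?L\<^esub> x" by (simp add: cone_order_def one_in_cone)
  show "x \<sqsubseteq>\<^bsub>?L\<^esub> y \<Longrightarrow> y \<sqsubseteq>\<^bsub>?L\<^esub> x \<Longrightarrow> x \<in> carrier ?L \<Longrightarrow> y \<in> carrier ?L \<Longrightarrow> x .=\<^bsub>?L\<^esub> y"
    by (simp add: cone_order_def cone_le_antisym)
  show "x \<sqsubseteq>\<^bsub>?L\<^esub> y \<Longrightarrow> y \<sqsubseteq>\<^bsub>?L\<^esub> z \<Longrightarrow> x \<in> carrier ?L \<Longrightarrow> y \<in> carrier ?L \<Longrightarrow> z \<in> carrier ?L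
      \<Longrightarrow> x \<sqsubseteq>\<^bsub>?L\<^esub> z"
    by (simp add: cone_order_def) (rule cone_le_trans[where y=y])
  show "x .=\<^bsub>?L\<^esub> y \<Longrightarrow> z .=\<^bsub>?L\<^esub> w \<Longrightarrow> (x \<sqsubseteq>\<^bsub>?L\<^esub> z) = (y \<sqsubseteq>\<^bsub>?L\<^esub> w)"
    by (simp add: cone_order_def)
  show "(.=\<^bsub>?L\<^esub>) = (=)" by (simp add: cone_order_def)
  show "x \<in> carrier ?L \<Longrightarrow> y \<in> carrier ?L \<Longrightarrow> \<exists>s. is_lub ?L s {x, y}"
    using cone_lub by (simp add: cone_order_def)
  show "x \<in> carrier ?L \<Longrightarrow> y \<in> carrier ?L \<Longrightarrow> \<exists>s. is_glb ?L s {x, y}"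
    using cone_glb by (simp add: cone_order_def)
qed

lemma
  assumes "x \<in> carrier G" "y \<in> carrier G"
  shows join_in_carrier [simp]: "x \<curlyvee> y \<in> carrier G"
    and join_upper1: "x \<preceq> x \<curlyvee> y"
    and join_upper2: "y \<preceq> x \<curlyvee> y"
    and meet_in_carrier [simp]: "x \<curlywedge> y \<in> carrier G"
    and meet_lower1: "x \<curlywedge> y \<preceq> x"
    and meet_lower2: "x \<curlywedge> y \<preceq> y"
proof -
  interpret L: lattice "cone_order G P" by (rule lattice_cone_order)
  show "x \<curlyvee> y \<in> carrier G" "x \<preceq> x \<curlyvee> y" "y \<preceq> x \<curlyvee> y"
    "x \<curlywedge> y \<in> carrier G" "x \<curlywedge> y \<preceq> x" "x \<curlywedge> y \<preceq> y"
    using assms L.join_closed[of x y] L.join_left[of x y] L.join_right[of x y]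
      L.meet_closed[of x y] L.meet_left[of x y] L.meet_right[of x y]
    by (simp_all add: cone_order_def)
qed

lemma join_least:
  assumes "x \<preceq> z" "y \<preceq> z" "x \<in> carrier G" "y \<in> carrier G" "z \<in> carrier G"
  shows "x \<curlyvee> y \<preceq> z"
proof -
  interpret L: lattice "cone_order G P" by (rule lattice_cone_order)
  show ?thesis using assms L.join_le[of x z y] by (simp add: cone_order_def)
qed

lemma meet_greatest:
  assumes "z \<preceq> x" "z \<preceq> y" "x \<in> carrier G" "y \<in> carrier G" "z \<in> carrier G"
  shows "z \<preceq> x \<curlywedge> y"
proof -
  interpret L: lattice "cone_order G P" by (rule lattice_cone_order)
  show ?thesis using assms L.meet_le[of z x y] by (simp add: cone_order_def)
qed

lemma cone_le_join_absorb:
  assumes "x \<preceq> y" "x \<in> carrier G" "y \<in> carrier G"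
  shows "x \<curlyvee> y = y" and "y \<curlyvee> x = y"
proof -
  show "x \<curlyvee> y = y"
    using assms join_upper2[of x y] join_least[of x y y] one_in_cone
    by (intro cone_le_antisym) auto
  then show "y \<curlyvee> x = y" by (simp add: join_comm)
qed

lemma cone_join_assoc:
  assumes "x \<in> carrier G" "y \<in> carrier G" "z \<in> carrier G"
  shows "(x \<curlyvee> y) \<curlyvee> z = x \<curlyvee> (y \<curlyvee> z)"
proof -
  interpret L: lattice "cone_order G P" by (rule lattice_cone_order)
  show ?thesis using assms L.weak_join_assoc[of x y z] by (simp add: cone_order_def)
qed

lemma cone_join_right_commute:
  assumes "x \<in> carrier G" "y \<in> carrier G" "z \<in> carrier G"
  shows "(x \<curlyvee> y) \<curlyvee> z = (x \<curlyvee> z) \<curlyvee> y"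
  using assms by (simp add: cone_join_assoc join_comm[of _ y z])

lemma cone_upward:
  assumes "p \<in> P" "p \<preceq> x" "x \<in> carrier G"
  shows "x \<in> P"
  using cone_mult[OF assms(1,2)] assms cone_closed by simp

lemma cone_join: "p \<in> P \<Longrightarrow> x \<in> carrier G \<Longrightarrow> p \<curlyvee> x \<in> P"
  by (meson cone_closed cone_upward join_in_carrier join_upper1)

lemma cone_meet: "p \<in> P \<Longrightarrow> q \<in> P \<Longrightarrow> p \<curlywedge> q \<in> P"
  using meet_greatest[of \<one> p q] by (simp add: cone_closed)

lemma join_mult_right:
  assumes [simp]: "x \<in> carrier G" "y \<in> carrier G" "z \<in> carrier G"
  shows "(x \<curlyvee> y) \<otimes> z = x \<otimes> z \<curlyvee> y \<otimes> z"
proof (rule cone_le_antisym)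
  have "x \<otimes> z \<otimes> inv z \<preceq> (x \<otimes> z \<curlyvee> y \<otimes> z) \<otimes> inv z"
    "y \<otimes> z \<otimes> inv z \<preceq> (x \<otimes> z \<curlyvee> y \<otimes> z) \<otimes> inv z"
    by (intro cone_le_mult_right join_upper1 join_upper2; simp)+
  then have "x \<curlyvee> y \<preceq> (x \<otimes> z \<curlyvee> y \<otimes> z) \<otimes> inv z"
    by (intro join_least) (simp_all add: m_assoc)
  from cone_le_mult_right[OF this, of z]
  show "(x \<curlyvee> y) \<otimes> z \<preceq> x \<otimes> z \<curlyvee> y \<otimes> z"
    by (simp add: m_assoc)
  show "x \<otimes> z \<curlyvee> y \<otimes> z \<preceq> (x \<curlyvee> y) \<otimes> z"
    by (intro join_least cone_le_mult_right join_upper1 join_upper2) simp_all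
qed simp_all

lemma join_mult_left:
  assumes [simp]: "x \<in> carrier G" "y \<in> carrier G" "z \<in> carrier G"
  shows "z \<otimes> (x \<curlyvee> y) = z \<otimes> x \<curlyvee> z \<otimes> y"
proof (rule cone_le_antisym)
  have "inv z \<otimes> (z \<otimes> x) \<preceq> inv z \<otimes> (z \<otimes> x \<curlyvee> z \<otimes> y)"
    "inv z \<otimes> (z \<otimes> y) \<preceq> inv z \<otimes> (z \<otimes> x \<curlyvee> z \<otimes> y)"
    by (intro cone_le_mult_left join_upper1 join_upper2; simp)+
  then have "x \<curlyvee> y \<preceq> inv z \<otimes> (z \<otimes> x \<curlyvee> z \<otimes> y)"
    by (intro join_least) simp_all
  from cone_le_mult_left[OF this, of z]
  show "z \<otimes> (x \<curlyvee> y) \<preceq> z \<otimes> x \<curlyvee> z \<otimes> y"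
    by simp
  show "z \<otimes> x \<curlyvee> z \<otimes> y \<preceq> z \<otimes> (x \<curlyvee> y)"
    by (intro join_least cone_le_mult_left join_upper1 join_upper2) simp_all
qed simp_all

lemma inv_meet:
  assumes [simp]: "x \<in> carrier G" "y \<in> carrier G"
  shows "inv (x \<curlywedge> y) = inv x \<curlyvee> inv y"
proof (rule cone_le_antisym)
  show "inv x \<curlyvee> inv y \<preceq> inv (x \<curlywedge> y)"
    by (intro join_least cone_le_inv meet_lower1 meet_lower2) simp_all
  have "inv (inv x \<curlyvee> inv y) \<preceq> inv (inv x)" "inv (inv x \<curlyvee> inv y) \<preceq> inv (inv y)"
    by (intro cone_le_inv join_upper1 join_upper2; simp)+
  then have "inv (inv x \<curlyvee> inv y) \<preceq> x \<curlywedge> y"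
    by (intro meet_greatest) simp_all
  from cone_le_inv[OF this]
  show "inv (x \<curlywedge> y) \<preceq> inv x \<curlyvee> inv y" by simp
qed simp_all

text \<open>Multiplying \<open>b\<^sup>-\<^sup>1 \<or> a\<^sup>-\<^sup>1 = (a \<and> b)\<^sup>-\<^sup>1 = e\<close> by \<open>a\<close> from the left and by \<open>b\<close> from the
  right gives the claim. In particular disjoint elements commute.\<close>

lemma disjoint_join:
  assumes "a \<curlywedge> b = \<one>" and [simp]: "a \<in> carrier G" "b \<in> carrier G"
  shows "a \<curlyvee> b = a \<otimes> b"
proof -
  have "a \<otimes> (inv b \<curlyvee> inv a) \<otimes> b = a \<curlyvee> b"
    by (simp add: join_mult_left join_mult_right m_assoc)
  moreover have "inv b \<curlyvee> inv a = \<one>"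
    using inv_meet[of a b] assms by (simp add: join_comm)
  ultimately show ?thesis by simp
qed

lemma disjoint_downward:
  assumes "a \<curlywedge> b = \<one>" "a' \<preceq> a" "b' \<preceq> b" "a' \<in> P" "b' \<in> P" "a \<in> P" "b \<in> P"
  shows "a' \<curlywedge> b' = \<one>"
proof (rule cone_le_antisym)
  have [simp]: "a \<in> carrier G" "b \<in> carrier G" "a' \<in> carrier G" "b' \<in> carrier G"
    using assms cone_closed by auto
  have "a' \<curlywedge> b' \<preceq> a \<curlywedge> b"
    using assms by (intro meet_greatest cone_le_trans[OF meet_lower1]
        cone_le_trans[OF meet_lower2]) auto
  then show "a' \<curlywedge> b' \<preceq> \<one>" using assms(1) by simp
  show "\<one> \<preceq> a' \<curlywedge> b'" using cone_meet[OF assms(4,5)] by (simp)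
qed (use assms cone_closed in auto)

text \<open>The element \<open>c = a \<and> (x \<or> y)\<close> is disjoint from \<open>x\<close>, so \<open>x c = x \<or> c \<le> x y\<close>. Cancelling \<open>x\<close>
  gives \<open>c \<le> a \<and> y\<close>.\<close>

lemma disjoint_join_right:
  assumes "a \<curlywedge> x = \<one>" "a \<curlywedge> y = \<one>" "a \<in> P" "x \<in> P" "y \<in> P"
  shows "a \<curlywedge> (x \<curlyvee> y) = \<one>"
proof -
  have [simp]: "a \<in> carrier G" "x \<in> carrier G" "y \<in> carrier G"
    using assms cone_closed by auto
  let ?c = "a \<curlywedge> (x \<curlyvee> y)"
  have cP: "?c \<in> P" using assms by (simp add: cone_meet cone_join)
  have ca: "?c \<preceq> a" by (simp add: meet_lower1)
  have "x \<preceq> x \<otimes> y" "y \<preceq> x \<otimes> y"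
    using assms(5) cone_le_mult_right[of \<one> x y] assms(4) by simp_all
  then have "x \<curlyvee> y \<preceq> x \<otimes> y" by (intro join_least) simp_all
  then have cxy: "?c \<preceq> x \<otimes> y"
    using meet_lower2[of a "x \<curlyvee> y"] cone_le_trans[of ?c "x \<curlyvee> y" "x \<otimes> y"] by simp
  have cx: "?c \<curlywedge> x = \<one>"
    using disjoint_downward[OF assms(1) ca _ cP assms(4)] assms one_in_cone by simp
  have "x \<curlywedge> ?c = \<one>" using cx by (simp add: meet_comm)
  then have "x \<otimes> ?c = x \<curlyvee> ?c" by (simp add: disjoint_join)
  also have "\<dots> \<preceq> x \<otimes> y"
    using \<open>x \<preceq> x \<otimes> y\<close> cxy by (intro join_least) simp_all
  finally have "?c \<preceq> y"
    using cone_le_mult_left[of "x \<otimes> ?c" "x \<otimes> y" "inv x"] by simp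
  then have "?c \<preceq> a \<curlywedge> y" using ca by (intro meet_greatest) simp_all
  then show ?thesis
    using assms(2) cP by (intro cone_le_antisym) simp_all
qed

lemma disjoint_remainders:
  assumes [simp]: "x \<in> carrier G" "y \<in> carrier G"
  shows "(x \<otimes> inv (x \<curlywedge> y)) \<curlywedge> (y \<otimes> inv (x \<curlywedge> y)) = \<one>"
proof -
  define b where "b = x \<curlywedge> y"
  have [simp]: "b \<in> carrier G" by (simp add: b_def)
  have "inv ((x \<otimes> inv b) \<curlywedge> (y \<otimes> inv b)) = b \<otimes> (inv x \<curlyvee> inv y)"
    by (simp add: inv_meet inv_mult_group join_mult_left)
  also have "inv x \<curlyvee> inv y = inv b" by (simp add: b_def inv_meet)
  finally have "inv ((x \<otimes> inv b) \<curlywedge> (y \<otimes> inv b)) = \<one>" by simp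
  then have "(x \<otimes> inv b) \<curlywedge> (y \<otimes> inv b) = \<one>"
    by (metis inv_inv inv_one m_closed inv_closed meet_in_carrier assms \<open>b \<in> carrier G\<close>)
  then show ?thesis by (simp add: b_def)
qed

text \<open>This turns \<open>\<langle>T(g\<^sub>-)\<^sup>* T(g\<^sub>+) h, k\<rangle>\<close> for \<open>g = x y\<^sup>-\<^sup>1\<close> into an expression in which \<open>x\<close> and \<open>y\<close>
  enter symmetrically through their join.\<close>

lemma pos_part_quotient:
  assumes [simp]: "x \<in> carrier G" "y \<in> carrier G"
  shows "pos_part G P (x \<otimes> inv y) = (x \<curlyvee> y) \<otimes> inv y"
    and "neg_part G P (x \<otimes> inv y) = (x \<curlyvee> y) \<otimes> inv x"
  by (simp_all add: pos_part_def neg_part_def join_mult_right inv_mult_group join_comm)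

end

section \<open>Alternating sums over joins\<close>

text \<open>Unfolding the recursion gives \<open>\<Sum>\<^bsub>S \<subseteq> as\<^esub> (-1)\<^bsup>|S|\<^esup> f(x \<or> \<Or>S)\<close>, the sum being over the
  sublists \<open>S\<close> of \<open>as\<close>. For \<open>f(x) = \<mu>({y. y \<ge> x})\<close> it is the measure of the elements above
  \<open>x\<close> that are above no entry of \<open>as\<close>.\<close>

primrec alternating_sum :: "('a \<Rightarrow> 'a \<Rightarrow> 'a) \<Rightarrow> ('a \<Rightarrow> real) \<Rightarrow> 'a \<Rightarrow> 'a list \<Rightarrow> real" where
  "alternating_sum jn f x [] = f x"
| "alternating_sum jn f x (a # as) = alternating_sum jn f x as - alternating_sum jn f (jn x a) as"

lemma alternating_sum_cong:
  assumes "x \<in> A" and "\<And>y a. y \<in> A \<Longrightarrow> a \<in> set as \<Longrightarrow> jn y a \<in> A" and "\<And>y. y \<in> A \<Longrightarrow> f y = g y"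
  shows "alternating_sum jn f x as = alternating_sum jn g x as"
  using assms by (induction as arbitrary: x) auto

lemma alternating_sum_add:
  "alternating_sum jn (\<lambda>y. f y + g y) x as = alternating_sum jn f x as + alternating_sum jn g x as"
  by (induction as arbitrary: x) auto

lemma alternating_sum_scale:
  "alternating_sum jn (\<lambda>y. c * f y) x as = c * alternating_sum jn f x as"
  by (induction as arbitrary: x) (auto simp: algebra_simps)

lemma alternating_sum_sum:
  "alternating_sum jn (\<lambda>y. \<Sum>i\<in>I. f i y) x as = (\<Sum>i\<in>I. alternating_sum jn (f i) x as)"
  by (induction as arbitrary: x) (auto simp: sum_subtractf)

lemma alternating_sum_bound:
  assumes "x \<in> A" and "\<And>y a. y \<in> A \<Longrightarrow> a \<in> set as \<Longrightarrow> jn y a \<in> A" and "\<And>y. y \<in> A \<Longrightarrow> \<bar>f y\<bar> \<le> M"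
  shows "\<bar>alternating_sum jn f x as\<bar> \<le> 2 ^ length as * M"
  using assms
proof (induction as arbitrary: x)
  case (Cons a as)
  then have "\<bar>alternating_sum jn f x as\<bar> \<le> 2 ^ length as * M"
    and "\<bar>alternating_sum jn f (jn x a) as\<bar> \<le> 2 ^ length as * M"
    by auto
  then show ?case by (simp add: abs_le_iff)
qed simp

context lattice_ordered_group
begin

abbreviation alt_sum :: "('a \<Rightarrow> real) \<Rightarrow> 'a \<Rightarrow> 'a list \<Rightarrow> real"
  where "alt_sum \<equiv> alternating_sum (\<curlyvee>)"

lemma alt_sum_remove:
  assumes "x \<in> carrier G" "set bs \<subseteq> carrier G" "c \<in> carrier G"
  shows "alt_sum f x (bs @ c # cs) = alt_sum f x (bs @ cs) - alt_sum f (x \<curlyvee> c) (bs @ cs)"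
  using assms by (induction bs arbitrary: x) (auto simp: cone_join_right_commute[of _ c])

text \<open>If \<open>a \<le> x\<close>, then the terms of \<open>S\<close> without \<open>a\<close> and of \<open>S\<close> extended by \<open>a\<close> cancel.\<close>

lemma alt_sum_absorb:
  assumes "a \<in> set as" "a \<preceq> x" "set as \<subseteq> carrier G" "x \<in> carrier G"
  shows "alt_sum f x as = 0"
  using assms
proof (induction as arbitrary: x)
  case (Cons b as)
  show ?case
  proof (cases "a = b")
    case True
    then show ?thesis using Cons.prems by (simp add: cone_le_join_absorb)
  next
    case False
    have "a \<preceq> x \<curlyvee> b"
      using Cons.prems by (intro cone_le_trans[OF _ join_upper1]) auto
    then show ?thesis using Cons False by simp
  qed
qed simp

lemma alt_sum_redundant:
  assumes "b \<preceq> c" "b \<in> set bs" "set bs \<subseteq> carrier G" "set cs \<subseteq> carrier G"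
    and "c \<in> carrier G" "x \<in> carrier G"
  shows "alt_sum f x (bs @ c # cs) = alt_sum f x (bs @ cs)"
proof -
  have "b \<preceq> x \<curlyvee> c"
    using assms by (intro cone_le_trans[OF assms(1) join_upper2]) auto
  then have "alt_sum f (x \<curlyvee> c) (bs @ cs) = 0"
    using assms by (intro alt_sum_absorb[of b]) auto
  then show ?thesis using assms by (simp add: alt_sum_remove)
qed

text \<open>This is the positive part of \<open>a r\<^sup>-\<^sup>1\<close>: what is left of \<open>a\<close> after \<open>r\<close> has been split off on the
  right.\<close>

abbreviation remainder :: "'a \<Rightarrow> 'a \<Rightarrow> 'a"
  where "remainder r a \<equiv> (a \<curlyvee> r) \<otimes> inv r"

lemma remainder_in_cone: "a \<in> carrier G \<Longrightarrow> r \<in> carrier G \<Longrightarrow> remainder r a \<in> P"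
  using cone_le_mult_right[OF join_upper2[of a r], of "inv r"] by simp

lemma remainder_le:
  assumes "a \<in> P" "r \<in> P"
  shows "remainder r a \<preceq> a"
proof -
  have [simp]: "a \<in> carrier G" "r \<in> carrier G" using assms cone_closed by auto
  have "r \<preceq> a \<otimes> r" using assms(1) cone_le_mult_right[of \<one> a r] by simp
  moreover have "a \<preceq> a \<otimes> r" using assms(2) by simp
  ultimately have "a \<curlyvee> r \<preceq> a \<otimes> r" by (intro join_least) simp_all
  from cone_le_mult_right[OF this, of "inv r"] show ?thesis by (simp add: m_assoc)
qed

text \<open>Right translation by \<open>r\<close> is an order isomorphism, and joining an element above \<open>r\<close> with \<open>a\<close> is
  the same as joining it with \<open>a \<or> r\<close>.\<close>

lemma alt_sum_translate:
  assumes "r \<in> carrier G" "set as \<subseteq> carrier G" "x \<in> P"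
  shows "alt_sum f (x \<otimes> r) as = alt_sum (\<lambda>y. f (y \<otimes> r)) x (map (remainder r) as)"
  using assms(2,3)
proof (induction as arbitrary: x)
  case (Cons a as)
  have [simp]: "r \<in> carrier G" "a \<in> carrier G" "x \<in> carrier G"
    using assms Cons.prems cone_closed by auto
  have "r \<preceq> x \<otimes> r" using Cons.prems cone_le_mult_right[of \<one> x r] by simp
  have "(x \<curlyvee> remainder r a) \<otimes> r = x \<otimes> r \<curlyvee> (a \<curlyvee> r)"
    by (subst join_mult_right) (simp_all add: m_assoc)
  also have "\<dots> = (x \<otimes> r \<curlyvee> r) \<curlyvee> a"
    by (simp add: cone_join_assoc join_comm[of _ a r])
  also have "\<dots> = x \<otimes> r \<curlyvee> a" using \<open>r \<preceq> x \<otimes> r\<close> by (simp add: cone_le_join_absorb)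
  finally have "(x \<curlyvee> remainder r a) \<otimes> r = x \<otimes> r \<curlyvee> a" .
  moreover have "x \<curlyvee> remainder r a \<in> P" using Cons.prems by (simp add: cone_join)
  ultimately show ?case using Cons by (metis (no_types, lifting) alternating_sum.simps(2)
     insert_subset list.set(2) list.simps(9))
qed simp

text \<open>All joins formed from \<open>x\<close> and \<open>as\<close> stay disjoint from \<open>a\<close>, so joining them with \<open>a\<close> is
  multiplying by \<open>a\<close>.\<close>

lemma disjoint_alt_sum:
  assumes "a \<in> P" "x \<in> P" "a \<curlywedge> x = \<one>" "set as \<subseteq> P" "\<And>b. b \<in> set as \<Longrightarrow> a \<curlywedge> b = \<one>"
  shows "alt_sum f (x \<curlyvee> a) as = alt_sum (\<lambda>y. f (y \<otimes> a)) x as"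
  using assms
proof (induction as arbitrary: x)
  case Nil
  then show ?case using disjoint_join[of x a] by (simp add: cone_closed meet_comm)
next
  case (Cons b as)
  have "x \<curlyvee> a \<curlyvee> b = x \<curlyvee> b \<curlyvee> a"
    using Cons.prems by (intro cone_join_right_commute) (auto simp: cone_closed)
  moreover have "a \<curlywedge> (x \<curlyvee> b) = \<one>" "x \<curlyvee> b \<in> P"
    using Cons.prems by (auto intro!: disjoint_join_right cone_join cone_closed)
  ultimately show ?case using Cons by simp
qed

end

section \<open>Positivity of the defect forms\<close>

locale nica_covariant_contraction = lattice_ordered_group G P for G (structure) and P +
  fixes T :: "'a \<Rightarrow> 'h \<Rightarrow> 'h::complex_hilbert_space"
  assumes representation: "semigroup_representation G P T"
    and contraction: "contractive P T"
    and covariance: "nica_covariant G P T"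
begin

lemma T_bounded_clinear: "p \<in> P \<Longrightarrow> bounded_clinear (T p)"
  using representation by (simp add: semigroup_representation_def)

lemma T_linear: "p \<in> P \<Longrightarrow> linear (T p)"
  using T_bounded_clinear bounded_clinear_bounded bounded_linear.linear by blast

lemma T_one: "T \<one> h = h"
  using representation by (simp add: semigroup_representation_def)

lemma T_mult: "p \<in> P \<Longrightarrow> q \<in> P \<Longrightarrow> T (p \<otimes> q) h = T p (T q h)"
  using representation by (simp add: semigroup_representation_def)

lemma T_norm_le: "p \<in> P \<Longrightarrow> norm (T p h) \<le> norm h"
proof -
  assume p: "p \<in> P"
  then have "norm (T p h) \<le> onorm (T p) * norm h"
    by (intro onorm bounded_clinear_bounded T_bounded_clinear)
  also have "\<dots> \<le> 1 * norm h"
    using contraction p by (intro mult_right_mono) (auto simp: contractive_def)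
  finally show ?thesis by simp
qed

lemma T_cadjoint_commute:
  "s \<in> P \<Longrightarrow> t \<in> P \<Longrightarrow> s \<curlywedge> t = \<one> \<Longrightarrow> T s (cadjoint (T t) h) = cadjoint (T t) (T s h)"
  using covariance by (simp add: nica_covariant_def fun_eq_iff)

lemma T_disjoint_commute:
  assumes "s \<in> P" "t \<in> P" "s \<curlywedge> t = \<one>"
  shows "T s (T t h) = T t (T s h)"
proof -
  have "s \<otimes> t = t \<otimes> s"
    using assms disjoint_join[of s t] disjoint_join[of t s]
    by (simp add: cone_closed meet_comm[of _ t s] join_comm[of _ t s])
  then show ?thesis using assms by (metis T_mult)
qed

text \<open>The diagonal values are \<open>\<Sum>\<^bsub>S \<subseteq> as\<^esub> (-1)\<^bsup>|S|\<^esup> \<parallel>T(\<Or>S) h\<parallel>\<^sup>2\<close>, which for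
  distinct generators of \<open>\<nat>\<^sup>m\<close> are the quantities that Brehmer's condition for regular dilations of
  commuting contractions requires to be nonnegative. For pairwise disjoint entries \<open>a\<^sub>1, \<dots>, a\<^sub>m\<close> it is the form of the product of the defect operators
  \<open>1 - T(a\<^sub>i)\<^sup>* T(a\<^sub>i)\<close>.\<close>

definition defect_form :: "'a list \<Rightarrow> 'h \<Rightarrow> 'h \<Rightarrow> real"
  where "defect_form as h k = alt_sum (\<lambda>x. rinner (T x h) (T x k)) \<one> as"

lemma defect_form_bilinear:
  assumes "set as \<subseteq> P"
  shows "bilinear (defect_form as)"
proof -
  have closed: "y \<curlyvee> a \<in> P" if "y \<in> P" "a \<in> set as" for y a
    using that assms by (auto intro: cone_join cone_closed)
  note cong = alternating_sum_cong[of \<one> P, OF one_in_cone closed]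
  show ?thesis
    unfolding bilinear_def defect_form_def
    by (auto intro!: linearI cong simp: alternating_sum_add[symmetric]
        alternating_sum_scale[symmetric] linear_add[OF T_linear] linear_scale[OF T_linear]
        rinner_simps)
qed

lemma defect_form_commute: "defect_form as h k = defect_form as k h"
  by (simp add: defect_form_def rinner_commute)

lemma defect_form_bound:
  assumes "set as \<subseteq> P"
  shows "defect_form as h h \<le> 2 ^ length as * (norm h)\<^sup>2"
proof -
  have "\<bar>defect_form as h h\<bar> \<le> 2 ^ length as * (norm h)\<^sup>2"
    unfolding defect_form_def
  proof (rule alternating_sum_bound[of _ P])
    show "y \<curlyvee> a \<in> P" if "y \<in> P" "a \<in> set as" for y a
      using that assms by (auto intro: cone_join cone_closed)
    show "\<bar>rinner (T y h) (T y h)\<bar> \<le> (norm h)\<^sup>2" if "y \<in> P" for y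
      using T_norm_le[OF that] by (simp add: rinner_self power_mono)
  qed (rule one_in_cone)
  then show ?thesis by linarith
qed

text \<open>Every join of entries of \<open>as\<close> is disjoint from \<open>a\<close>; by Nica covariance \<open>T\<close> of it commutes with
  both \<open>T(a)\<close> and \<open>T(a)\<^sup>*\<close>.\<close>

lemma defect_form_adjoint:
  assumes "a \<in> P" "set as \<subseteq> P" "\<And>b. b \<in> set as \<Longrightarrow> a \<curlywedge> b = \<one>"
  shows "defect_form as (T a h) k = defect_form as h (cadjoint (T a) k)"
  unfolding defect_form_def
proof (rule alternating_sum_cong[where A="{x \<in> P. a \<curlywedge> x = \<one>}"])
  show "\<one> \<in> {x \<in> P. a \<curlywedge> x = \<one>}"
    using assms(1) one_in_cone meet_lower2[of a \<one>] cone_meet[of a \<one>]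
    by (auto intro!: cone_le_antisym simp: cone_closed)
  show "y \<curlyvee> b \<in> {x \<in> P. a \<curlywedge> x = \<one>}" if "y \<in> {x \<in> P. a \<curlywedge> x = \<one>}" "b \<in> set as" for y b
    using that assms by (auto intro!: cone_join cone_closed disjoint_join_right)
  fix y assume "y \<in> {x \<in> P. a \<curlywedge> x = \<one>}"
  then have y: "y \<in> P" "y \<curlywedge> a = \<one>" by (auto simp: meet_comm)
  show "rinner (T y (T a h)) (T y k) = rinner (T y h) (T y (cadjoint (T a) k))"
    using y assms(1)
    by (simp add: T_disjoint_commute T_cadjoint_commute rinner_cadjoint T_bounded_clinear)
qed

text \<open>Above \<open>r\<close> the operators factor as \<open>T(y r) = T(y) T(r)\<close>, so moving the base point from \<open>x r\<close>
  to \<open>x\<close> replaces the vector \<open>h\<close> by \<open>T(r) h\<close>.\<close>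

lemma alt_sum_translate_base:
  assumes "r \<in> P" "x \<in> P" "set as \<subseteq> carrier G"
  shows "alt_sum (\<lambda>y. rinner (T y h) (T y h)) (x \<otimes> r) as
    = alt_sum (\<lambda>y. rinner (T y (T r h)) (T y (T r h))) x (map (remainder r) as)"
proof -
  have "alt_sum (\<lambda>y. rinner (T y h) (T y h)) (x \<otimes> r) as
    = alt_sum (\<lambda>y. rinner (T (y \<otimes> r) h) (T (y \<otimes> r) h)) x (map (remainder r) as)"
    using assms by (simp add: alt_sum_translate cone_closed)
  also have "\<dots> = alt_sum (\<lambda>y. rinner (T y (T r h)) (T y (T r h))) x (map (remainder r) as)"
    using assms cone_closed[OF assms(1)]
    by (intro alternating_sum_cong[of _ P]) (auto simp: T_mult intro!: cone_join)
  finally show ?thesis .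
qed

lemma defect_form_Cons_disjoint:
  assumes "a \<in> P" "set as \<subseteq> P" "\<And>b. b \<in> set as \<Longrightarrow> a \<curlywedge> b = \<one>"
  shows "defect_form (a # as) h h = defect_form as h h - defect_form as (T a h) (T a h)"
proof -
  have "a \<curlywedge> \<one> = \<one>"
    using assms(1) one_in_cone meet_lower2[of a \<one>] cone_meet[of a \<one>]
    by (auto intro!: cone_le_antisym simp: cone_closed)
  then have "alt_sum (\<lambda>y. rinner (T y h) (T y h)) (\<one> \<curlyvee> a) as
    = alt_sum (\<lambda>y. rinner (T (y \<otimes> a) h) (T (y \<otimes> a) h)) \<one> as"
    using assms one_in_cone by (intro disjoint_alt_sum) auto
  also have "\<dots> = defect_form as (T a h) (T a h)"
    unfolding defect_form_def using assms one_in_cone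
    by (intro alternating_sum_cong[of _ P]) (auto simp: T_mult intro!: cone_join cone_closed)
  finally show ?thesis by (simp add: defect_form_def)
qed

text \<open>The two forms with first entries \<open>a\<close> and \<open>b\<close> differ by the alternating sum at base point \<open>b\<close>
  minus the one at base point \<open>a\<close>. Both base points lie above \<open>b\<close>, and translating \<open>b\<close> to the
  identity turns this difference into a defect form at \<open>T(b) h\<close>.\<close>

lemma defect_form_split:
  assumes "a \<in> P" "b \<in> P" "b \<preceq> a" "set as \<subseteq> P"
  shows "defect_form (a # as) h h = defect_form (b # as) h h
    + defect_form (a \<otimes> inv b # map (remainder b) as) (T b h) (T b h)"
proof -
  have [simp]: "a \<in> carrier G" "b \<in> carrier G" and as: "set as \<subseteq> carrier G"
    using assms cone_closed by auto
  have quot: "a \<otimes> inv b \<in> P"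
    using cone_le_mult_right[OF assms(3), of "inv b"] by simp
  have "\<one> \<curlyvee> a = a" "\<one> \<curlyvee> b = b" "\<one> \<curlyvee> a \<otimes> inv b = a \<otimes> inv b"
    using assms quot by (simp_all add: cone_le_join_absorb)
  then show ?thesis
    using alt_sum_translate_base[OF assms(2) one_in_cone as, of h]
      alt_sum_translate_base[OF assms(2) quot as, of h]
    by (simp add: defect_form_def m_assoc)
qed

text \<open>The entry \<open>a\<close> is made disjoint from the entries of \<open>cs\<close> one after the other: each step moves one
  entry from \<open>cs\<close> to \<open>bs\<close>. The list changes to its remainders in each step, hence the induction
  on the length of \<open>cs\<close>.\<close>

lemma defect_form_nonneg_disjoint_prefix:
  assumes shorter: "\<And>bs h. length bs < n \<Longrightarrow> set bs \<subseteq> P \<Longrightarrow> 0 \<le> defect_form bs h h"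
    and "length (a # bs @ cs) = n" "a \<in> P" "set bs \<subseteq> P" "set cs \<subseteq> P"
    and "\<And>b. b \<in> set bs \<Longrightarrow> a \<curlywedge> b = \<one>"
  shows "0 \<le> defect_form (a # bs @ cs) h h"
  using assms(2-)
proof (induction "length cs" arbitrary: a bs cs h)
  case 0
  then have Nil: "length bs < n" "a \<in> P" "set bs \<subseteq> P" "\<And>b. b \<in> set bs \<Longrightarrow> a \<curlywedge> b = \<one>"
    and cs: "cs = []"
    by auto
  have "defect_form bs (T a h) (T a h) \<le> defect_form bs h h"
  proof (rule psd_form_contraction[where \<beta>="defect_form bs" and A="T a" and B="cadjoint (T a)"])
    show "bilinear (defect_form bs)" using Nil by (intro defect_form_bilinear)
    show "defect_form bs x y = defect_form bs y x" for x y by (rule defect_form_commute)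
    show "0 \<le> defect_form bs x x" for x using Nil shorter by auto
    show "defect_form bs x x \<le> 2 ^ length bs * (norm x)\<^sup>2" for x
      using Nil by (intro defect_form_bound)
    show "defect_form bs (T a x) y = defect_form bs x (cadjoint (T a) y)" for x y
      using Nil by (intro defect_form_adjoint)
    show "norm (T a x) \<le> norm x" for x using Nil T_norm_le by blast
    show "norm (cadjoint (T a) x) \<le> norm x" for x
      using norm_cadjoint_le[of "T a" 1 x] Nil T_norm_le T_bounded_clinear by simp
  qed
  then show ?case using Nil cs by (simp add: defect_form_Cons_disjoint)
next
  case (Suc m)
  then obtain c cs' where Cons: "cs = c # cs'" "m = length cs'" by (metis length_Suc_conv)
  define b where "b = a \<curlywedge> c"
  have P: "a \<in> P" "c \<in> P" "set bs \<subseteq> P" "set cs' \<subseteq> P" "set (bs @ c # cs') \<subseteq> P"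
    using Suc.prems Cons by auto
  then have [simp]: "a \<in> carrier G" "c \<in> carrier G" using cone_closed by auto
  have bP: "b \<in> P" using P by (simp add: b_def cone_meet)
  then have [simp]: "b \<in> carrier G" by (rule cone_closed)
  have le: "b \<preceq> a" "b \<preceq> c" by (simp_all add: b_def meet_lower1 meet_lower2)
  let ?a = "a \<otimes> inv b" and ?bs = "map (remainder b) bs @ [c \<otimes> inv b]"
    and ?cs = "map (remainder b) cs'"
  have carr: "set bs \<subseteq> carrier G" "set cs' \<subseteq> carrier G" using P cone_closed by auto
  have aP: "?a \<in> P" "c \<otimes> inv b \<in> P"
    using cone_le_mult_right[OF le(1), of "inv b"] cone_le_mult_right[OF le(2), of "inv b"]
    by simp_all
  \<comment> \<open>Anything above \<open>c\<close> is above \<open>b\<close>, which makes \<open>c\<close> redundant and shortens the list.\<close>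
  have "defect_form (b # bs @ c # cs') h h = defect_form (b # bs @ cs') h h"
    using alt_sum_redundant[of b c "b # bs" cs'] le carr by (simp add: defect_form_def)
  moreover have "0 \<le> defect_form (b # bs @ cs') h h"
    using shorter[of "b # bs @ cs'"] Suc.prems(1) Cons bP P by simp
  moreover have "0 \<le> defect_form (?a # ?bs @ ?cs) (T b h) (T b h)"
  proof (rule Suc.hyps(1))
    show "m = length ?cs" using Cons by simp
    show "length (?a # ?bs @ ?cs) = n" using Suc.prems(1) Cons by simp
    show "?a \<in> P" by (rule aP)
    show "set ?bs \<subseteq> P" "set ?cs \<subseteq> P" using carr aP remainder_in_cone by auto
    fix d assume "d \<in> set ?bs"
    then consider "d = c \<otimes> inv b" | d' where "d' \<in> set bs" "d = remainder b d'" by auto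
    then show "?a \<curlywedge> d = \<one>"
    proof cases
      case 1
      then show ?thesis using disjoint_remainders[of a c] by (simp add: b_def)
    next
      case (2 d')
      \<comment> \<open>Remainders only decrease, so the disjointness from earlier steps persists.\<close>
      have "?a \<preceq> a"
        using remainder_le[OF P(1) bP] le by (simp add: cone_le_join_absorb)
      moreover have "d' \<in> P" "a \<curlywedge> d' = \<one>" using 2 P Suc.prems(5) by auto
      ultimately show ?thesis
        using 2(2) P(1) aP(1) bP
        by (intro disjoint_downward[OF _ _ remainder_le[OF _ bP, of d'], of a ?a, folded 2(2)])
          (simp_all add: remainder_in_cone cone_closed)
    qed
  qed
  moreover have "defect_form (a # bs @ c # cs') h h = defect_form (b # bs @ c # cs') h h
      + defect_form (?a # ?bs @ ?cs) (T b h) (T b h)"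
    using defect_form_split[OF P(1) bP le(1) P(5), of h] le
    by (simp add: cone_le_join_absorb)
  ultimately show ?case using Cons by simp
qed

theorem defect_form_nonneg:
  assumes "set as \<subseteq> P"
  shows "0 \<le> defect_form as h h"
  using assms
proof (induction "length as" arbitrary: as h rule: less_induct)
  case less
  show ?case
  proof (cases as)
    case Nil
    then show ?thesis by (simp add: defect_form_def rinner_self)
  next
    case (Cons a cs)
    then show ?thesis
      using defect_form_nonneg_disjoint_prefix[of "length as" a "[]" cs h] less by auto
  qed
qed

end

section \<open>Moebius inversion and regularity\<close>

lemma (in lattice_ordered_group) finite_join_closure:
  assumes "finite X" "X \<subseteq> carrier G"
  shows "\<exists>F. finite F \<and> X \<subseteq> F \<and> F \<subseteq> carrier G \<and> (\<forall>x\<in>F. \<forall>y\<in>F. x \<curlyvee> y \<in> F)"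
  using assms
proof (induction X rule: finite_induct)
  case empty
  then show ?case by auto
next
  case (insert x X)
  then have "X \<subseteq> carrier G" by simp
  from insert.IH[OF this] obtain F where F: "finite F" "X \<subseteq> F" "F \<subseteq> carrier G" "\<forall>y\<in>F. \<forall>z\<in>F. y \<curlyvee> z \<in> F"
    by (elim exE conjE)
  have closed: "y \<curlyvee> z \<in> F" if "y \<in> F" "z \<in> F" for y z
    using F(4) that by blast
  have x[simp]: "x \<in> carrier G" and Fc[simp]: "\<And>y. y \<in> F \<Longrightarrow> y \<in> carrier G"
    using insert.prems F by auto
  let ?F = "insert x (F \<union> (\<lambda>y. x \<curlyvee> y) ` F)"
  have xx: "x \<curlyvee> x = x" by (simp add: cone_le_join_absorb one_in_cone)
  have x_join: "x \<curlyvee> z \<in> ?F" if "z \<in> ?F" for z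
    using that by (auto simp: xx simp flip: cone_join_assoc)
  have F_join: "y \<curlyvee> z \<in> ?F" if "y \<in> F" "z \<in> ?F" for y z
  proof -
    have "y \<curlyvee> (x \<curlyvee> w) = x \<curlyvee> (y \<curlyvee> w)" if "w \<in> F" for w
      using that \<open>y \<in> F\<close> by (metis cone_join_assoc join_comm x Fc)
    then show ?thesis using that closed by (auto simp: join_comm[of _ y x])
  qed
  have "y \<curlyvee> z \<in> ?F" if "y \<in> ?F" "z \<in> ?F" for y z
  proof -
    consider "y = x" | "y \<in> F" | w where "w \<in> F" "y = x \<curlyvee> w" using \<open>y \<in> ?F\<close> by auto
    then show ?thesis
    proof cases
      case (3 w)
      have "z \<in> carrier G" using \<open>z \<in> ?F\<close> by auto
      then have "y \<curlyvee> z = x \<curlyvee> (w \<curlyvee> z)" using 3 by (simp add: cone_join_assoc)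
      then show ?thesis using x_join F_join 3(1) \<open>z \<in> ?F\<close> by simp
    qed (use x_join F_join \<open>z \<in> ?F\<close> in simp_all)
  qed
  then have "\<forall>y\<in>?F. \<forall>z\<in>?F. y \<curlyvee> z \<in> ?F" by blast
  moreover have "finite ?F" "insert x X \<subseteq> ?F" "?F \<subseteq> carrier G" using F by auto
  ultimately show ?case by (intro exI[of _ ?F] conjI)
qed

context nica_covariant_contraction
begin

text \<open>At \<open>x = q\<^sub>i \<or> q\<^sub>j\<close> this is the real part of \<open>\<langle>T(g\<^sub>-)\<^sup>* T(g\<^sub>+) h\<^sub>j, h\<^sub>i\<rangle>\<close> for
  \<open>g = q\<^sub>i q\<^sub>j\<^sup>-\<^sup>1\<close>. Separating \<open>x\<close> from the indices makes alternating sums in \<open>x\<close> possible.\<close>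

definition extension_kernel :: "('i \<Rightarrow> 'a) \<Rightarrow> ('i \<Rightarrow> 'h) \<Rightarrow> 'i \<Rightarrow> 'i \<Rightarrow> 'a \<Rightarrow> real"
  where "extension_kernel q h i j x = rinner (T (x \<otimes> inv (q j)) (h j)) (T (x \<otimes> inv (q i)) (h i))"

text \<open>With \<open>v = \<Sum>\<^sub>i T(r q\<^sub>i\<^sup>-\<^sup>1) h\<^sub>i\<close> the double sum of \<open>k\<^sub>i\<^sub>j(y r)\<close> is \<open>\<parallel>T(y) v\<parallel>\<^sup>2\<close> for all \<open>y\<close> in the
  cone, so the double sum of alternating sums is a defect form at \<open>v\<close>.\<close>

lemma kernel_sum_nonneg_above:
  assumes "finite I" "\<And>i. i \<in> I \<Longrightarrow> q i \<in> carrier G" "\<And>i. i \<in> I \<Longrightarrow> q i \<preceq> r"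
    and r[simp]: "r \<in> carrier G" and as: "set as \<subseteq> carrier G"
  shows "0 \<le> (\<Sum>i\<in>I. \<Sum>j\<in>I. alt_sum (extension_kernel q h i j) r as)"
proof -
  let ?v = "\<Sum>i\<in>I. T (r \<otimes> inv (q i)) (h i)"
  have quot: "r \<otimes> inv (q i) \<in> P" if "i \<in> I" for i
    using cone_le_mult_right[OF assms(3)[OF that], of "inv (q i)"] assms(2)[OF that] by simp
  have "(\<Sum>i\<in>I. \<Sum>j\<in>I. alt_sum (extension_kernel q h i j) r as)
    = alt_sum (\<lambda>x. \<Sum>i\<in>I. \<Sum>j\<in>I. extension_kernel q h i j x) (\<one> \<otimes> r) as"
    by (simp add: alternating_sum_sum)
  also have "\<dots> = alt_sum (\<lambda>y. \<Sum>i\<in>I. \<Sum>j\<in>I. extension_kernel q h i j (y \<otimes> r)) \<one> (map (remainder r) as)"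
    using as one_in_cone by (intro alt_sum_translate) simp_all
  also have "\<dots> = defect_form (map (remainder r) as) ?v ?v"
    unfolding defect_form_def
  proof (rule alternating_sum_cong[of _ P])
    show "y \<curlyvee> a \<in> P" if "y \<in> P" "a \<in> set (map (remainder r) as)" for y a
      using that as by (auto intro!: cone_join cone_closed[OF remainder_in_cone])
    fix y assume y: "y \<in> P"
    have "T (y \<otimes> r \<otimes> inv (q i)) (h i) = T y (T (r \<otimes> inv (q i)) (h i))" if "i \<in> I" for i
      using y quot[OF that] assms(2)[OF that] by (simp add: cone_closed m_assoc flip: T_mult)
    then have "(\<Sum>i\<in>I. \<Sum>j\<in>I. extension_kernel q h i j (y \<otimes> r)) =
        (\<Sum>i\<in>I. \<Sum>j\<in>I. rinner (T y (T (r \<otimes> inv (q i)) (h i))) (T y (T (r \<otimes> inv (q j)) (h j))))"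
      unfolding extension_kernel_def by (intro sum.cong refl) (simp add: rinner_commute)
    also have "\<dots> = rinner (T y ?v) (T y ?v)"
      by (simp add: linear_sum[OF T_linear[OF y]] bilinear_sum[OF rinner_bilinear]
          sum.cartesian_product)
    finally show "(\<Sum>i\<in>I. \<Sum>j\<in>I. extension_kernel q h i j (y \<otimes> r)) = rinner (T y ?v) (T y ?v)" .
  qed (rule one_in_cone)
  also have "0 \<le> \<dots>"
    using as by (intro defect_form_nonneg) (auto intro: remainder_in_cone)
  finally show ?thesis .
qed

text \<open>The upward closed list \<open>L\<close> holds the elements of \<open>F\<close> that have already been split off. When it
  exhausts \<open>F\<close>, every base point \<open>q\<^sub>i \<or> q\<^sub>j\<close> is absorbed and the sum vanishes. Otherwise a maximal
  element \<open>r\<close> of the rest is split off; the difference is the contribution of \<open>r\<close>. The case of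
  interest is the empty list.\<close>

lemma kernel_sum_nonneg:
  fixes n :: nat
  assumes F: "finite F" "F \<subseteq> carrier G" "\<And>x y. x \<in> F \<Longrightarrow> y \<in> F \<Longrightarrow> x \<curlyvee> y \<in> F"
    and q: "\<And>i. i < n \<Longrightarrow> q i \<in> F"
    and L: "set L \<subseteq> F" "\<And>p x. p \<in> set L \<Longrightarrow> x \<in> F \<Longrightarrow> p \<preceq> x \<Longrightarrow> x \<in> set L"
  shows "0 \<le> (\<Sum>i<n. \<Sum>j<n. alt_sum (extension_kernel q h i j) (q i \<curlyvee> q j) L)"
  using L
proof (induction "card (F - set L)" arbitrary: L rule: less_induct)
  case less
  have carr: "set L \<subseteq> carrier G" using less.prems(1) F(2) by blast
  have qF: "q i \<curlyvee> q j \<in> F" if "i < n" "j < n" for i j using F(3) q that by blast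
  have absorb: "alt_sum f x L = 0" if "x \<in> set L" for f x
    using that carr one_in_cone by (intro alt_sum_absorb[of x]) auto
  show ?case
  proof (cases "F - set L = {}")
    case True
    then have "alt_sum (extension_kernel q h i j) (q i \<curlyvee> q j) L = 0" if "i < n" "j < n" for i j
      using qF[OF that] by (intro absorb) auto
    then show ?thesis by simp
  next
    case False
    have "\<exists>r\<in>F - set L. \<forall>x\<in>F - set L. x \<noteq> r \<longrightarrow> \<not> (r \<preceq> x \<and> r \<noteq> x)"
    proof (rule Finite_Set.bex_max_element)
      show "asymp_on (F - set L) (\<lambda>r x. r \<preceq> x \<and> r \<noteq> x)"
        using F(2) by (intro asymp_onI) (auto dest: cone_le_antisym)
      show "transp_on (F - set L) (\<lambda>r x. r \<preceq> x \<and> r \<noteq> x)"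
      proof (intro transp_onI conjI; elim conjE)
        fix x y z assume xyz: "x \<in> F - set L" "y \<in> F - set L" "z \<in> F - set L"
          and le: "x \<preceq> y" "x \<noteq> y" "y \<preceq> z" "y \<noteq> z"
        have carrier: "x \<in> carrier G" "y \<in> carrier G" "z \<in> carrier G" using xyz F(2) by auto
        then show "x \<preceq> z" using le cone_le_trans by blast
        show "x \<noteq> z" using le carrier cone_le_antisym by blast
      qed
    qed (use F(1) False in auto)
    then obtain r where r: "r \<in> F" "r \<notin> set L"
      and above: "\<And>x. x \<in> F \<Longrightarrow> r \<preceq> x \<Longrightarrow> x \<noteq> r \<Longrightarrow> x \<in> set L" by blast
    have [simp]: "r \<in> carrier G" using r F by blast
    define I where "I = {i. i < n \<and> q i \<preceq> r}"
    have qc: "q i \<in> carrier G" if "i < n" for i using that q F(2) by blast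
    let ?X = "\<lambda>i j. alt_sum (extension_kernel q h i j) (q i \<curlyvee> q j \<curlyvee> r) L"
    \<comment> \<open>Unless \<open>q\<^sub>i \<or> q\<^sub>j \<or> r\<close> is \<open>r\<close> itself, it lies in \<open>F\<close> strictly above \<open>r\<close>, hence in \<open>L\<close>, and
      absorbs.\<close>
    have X: "?X i j = (if i \<in> I \<and> j \<in> I then alt_sum (extension_kernel q h i j) r L else 0)"
      if "i < n" "j < n" for i j
    proof (cases "q i \<curlyvee> q j \<curlyvee> r = r")
      case True
      have "q i \<preceq> q i \<curlyvee> q j \<curlyvee> r" "q j \<preceq> q i \<curlyvee> q j \<curlyvee> r"
        using that qc
        by (auto intro!: cone_le_trans[OF join_upper1 join_upper1]
            cone_le_trans[OF join_upper2 join_upper1])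
      then show ?thesis using True that by (simp add: I_def)
    next
      case False
      then have "q i \<curlyvee> q j \<curlyvee> r \<in> set L"
        using that qc by (auto intro!: above F(3) q r join_upper2)
      moreover have "\<not> (i \<in> I \<and> j \<in> I)"
      proof
        assume "i \<in> I \<and> j \<in> I"
        then have "q i \<curlyvee> q j \<preceq> r" using that qc by (intro join_least) (auto simp: I_def)
        then show False using False that qc by (simp add: cone_le_join_absorb)
      qed
      ultimately show ?thesis by (auto simp: absorb)
    qed
    have I: "{..<n} \<inter> I = I" by (auto simp: I_def)
    have "(\<Sum>i<n. \<Sum>j<n. ?X i j)
      = (\<Sum>i<n. \<Sum>j<n. if i \<in> I then if j \<in> I then alt_sum (extension_kernel q h i j) r L else 0 else 0)"
      by (intro sum.cong refl) (auto simp: X)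
    also have "\<dots> = (\<Sum>i<n. if i \<in> I then \<Sum>j\<in>I. alt_sum (extension_kernel q h i j) r L else 0)"
      by (intro sum.cong refl) (simp add: sum.inter_restrict[symmetric] I)
    also have "\<dots> = (\<Sum>i\<in>I. \<Sum>j\<in>I. alt_sum (extension_kernel q h i j) r L)"
      by (simp add: sum.inter_restrict[symmetric] I)
    also have "0 \<le> \<dots>"
      using carr qc by (intro kernel_sum_nonneg_above) (auto simp: I_def)
    finally have "0 \<le> (\<Sum>i<n. \<Sum>j<n. ?X i j)" .
    moreover have "0 \<le> (\<Sum>i<n. \<Sum>j<n. alt_sum (extension_kernel q h i j) (q i \<curlyvee> q j) (r # L))"
    proof (rule less.hyps)
      show "card (F - set (r # L)) < card (F - set L)"
        using r F(1) by (intro psubset_card_mono) auto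
      show "set (r # L) \<subseteq> F" using r less.prems by simp
      show "x \<in> set (r # L)" if "p \<in> set (r # L)" "x \<in> F" "p \<preceq> x" for p x
        using that above less.prems(2) by auto
    qed
    ultimately show ?thesis by (simp add: sum_subtractf)
  qed
qed

lemma cinner_regular_extension:
  assumes [simp]: "x \<in> carrier G" "y \<in> carrier G"
  shows "cinner (regular_extension G P T (x \<otimes> inv y) h) k
    = cinner (T ((x \<curlyvee> y) \<otimes> inv y) h) (T ((x \<curlyvee> y) \<otimes> inv x) k)"
proof -
  have "(x \<curlyvee> y) \<otimes> inv x \<in> P"
    using cone_le_mult_right[OF join_upper1[of x y], of "inv x"] by simp
  then have "cinner (cadjoint (T ((x \<curlyvee> y) \<otimes> inv x)) u) k = cinner u (T ((x \<curlyvee> y) \<otimes> inv x) k)"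
    for u
    using cinner_cadjoint[OF T_bounded_clinear] cinner_commute by metis
  then show ?thesis by (simp add: regular_extension_def pos_part_quotient)
qed

lemma regular_extension_bounded_clinear:
  assumes [simp]: "g \<in> carrier G"
  shows "bounded_clinear (regular_extension G P T g)"
proof -
  have "pos_part G P g \<in> P" "neg_part G P g \<in> P"
    using join_upper2[of g \<one>] join_upper2[of "inv g" \<one>]
    by (simp_all add: pos_part_def neg_part_def)
  then show ?thesis
    unfolding regular_extension_def
    by (intro bounded_clinear_compose bounded_clinear_cadjoint T_bounded_clinear)
qed

lemma regular_extension_one: "regular_extension G P T \<one> = id"
proof -
  have "\<one> \<curlyvee> \<one> = \<one>" by (simp add: cone_le_join_absorb one_in_cone)
  moreover have "T \<one> = id" by (auto simp: T_one)
  moreover have "cadjoint id = (id :: 'h \<Rightarrow> 'h)" by (rule cadjoint_unique) simp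
  ultimately show ?thesis by (simp add: regular_extension_def pos_part_def neg_part_def)
qed

lemma regular_extension_matrix_nonneg:
  assumes g: "\<And>i. i < n \<Longrightarrow> g i \<in> carrier G"
  shows "opmat_nonneg n (\<lambda>i j. regular_extension G P T (inv (g i) \<otimes> g j))"
  unfolding opmat_nonneg_def
proof
  fix h :: "nat \<Rightarrow> 'h"
  define q where "q i = inv (g i)" for i
  have q[simp]: "q i \<in> carrier G" if "i < n" for i using that g by (simp add: q_def)
  define c where "c i j = cinner (T ((q i \<curlyvee> q j) \<otimes> inv (q j)) (h j))
    (T ((q i \<curlyvee> q j) \<otimes> inv (q i)) (h i))" for i j
  let ?s = "direct_sum_cinner n
    (opmat_apply n (\<lambda>i j. regular_extension G P T (inv (g i) \<otimes> g j)) h) h"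
  have cinner_sum: "cinner (sum f A) z = (\<Sum>x\<in>A. cinner (f x) z)" for f A and z :: 'h
  proof -
    interpret additive "\<lambda>x. cinner x z" by standard (rule cinner_add_left)
    show ?thesis by (rule sum)
  qed
  have entry: "cinner (regular_extension G P T (inv (g i) \<otimes> g j) (h j)) (h i) = c i j"
    if "i < n" "j < n" for i j
    using cinner_regular_extension[of "q i" "q j"] that g by (simp add: c_def q_def)
  have s: "?s = (\<Sum>i<n. \<Sum>j<n. c i j)"
    by (simp add: direct_sum_cinner_def opmat_apply_def cinner_sum entry)
  \<comment> \<open>The matrix is Hermitian, so its quadratic form is real.\<close>
  have "cnj (c i j) = c j i" for i j
    unfolding c_def by (subst cinner_commute) (simp add: join_comm[of _ "q i" "q j"])
  then have "cnj ?s = (\<Sum>i<n. \<Sum>j<n. c j i)" by (simp add: s)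
  also have "\<dots> = ?s" unfolding s by (rule sum.swap)
  finally have real: "Im ?s = 0" by (simp add: complex_eq_iff)
  have "q ` {..<n} \<subseteq> carrier G" by auto
  then obtain F where F: "finite F" "q ` {..<n} \<subseteq> F" "F \<subseteq> carrier G"
    and closed: "\<And>x y. x \<in> F \<Longrightarrow> y \<in> F \<Longrightarrow> x \<curlyvee> y \<in> F"
    using finite_join_closure[of "q ` {..<n}"] by (metis finite_imageI finite_lessThan)
  have "0 \<le> (\<Sum>i<n. \<Sum>j<n. alt_sum (extension_kernel q h i j) (q i \<curlyvee> q j) [])"
    by (rule kernel_sum_nonneg[OF F(1,3) closed]) (use F(2) in auto)
  also have "\<dots> = Re ?s" by (simp add: s c_def extension_kernel_def rinner_def)
  finally show "?s \<in> \<real>\<^sub>\<ge>\<^sub>0" using real by (simp add: complex_nonneg_Reals_iff)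
qed

end

theorem theorem4p1:
  fixes G :: "('g, 'm) monoid_scheme" and P :: "'g set"
    and T :: "'g \<Rightarrow> 'h \<Rightarrow> 'h::complex_hilbert_space"
  assumes "lattice_ordered_group G P"
    and "semigroup_representation G P T"
    and "contractive P T"
    and "nica_covariant G P T"
  shows "regular G P T"
proof -
  interpret nica_covariant_contraction G P T
    using assms
    by (rule nica_covariant_contraction.intro[OF _ nica_covariant_contraction_axioms.intro])
  show ?thesis
    unfolding regular_def completely_positive_definite_def
    by (intro conjI ballI allI impI regular_extension_bounded_clinear regular_extension_one
        regular_extension_matrix_nonneg) auto
qed

end
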